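(* Let $k\ge4$ be an integer and $0<\delta<1/2$. Then $$\mathrm{Emb}(1,\delta,k)\ge\frac15\,\frac{2^k\log(1/\delta)}{\log k}.$$
   Context: $\log$ is base 2. $\{0,1\}^N$ carries the Hamming metric $\|x-y\|_1$. $\mathrm{Emb}(1,\delta,k)$ is the smallest $N$ such that for every $\mathcal D\subset\{0,1\}^N$ with $|\mathcal D|\ge\delta2^N$ there exist $r>0$ and $f:\{0,1\}^k\to\mathcal D$ with $\|f(x)-f(y)\|_1=r\|x-y\|_1$ for all $x,y\in\{0,1\}^k$. *)

theory Defs
  imports Complex_Main "HOL-Library.FuncSet"
begin

definition cube :: "nat \<Rightarrow> (nat \<Rightarrow> real) set" where
  "cube N = ({..<N} \<rightarrow>\<^sub>E {0, 1})"

definition l1_dist :: "nat \<Rightarrow> (nat \<Rightarrow> real) \<Rightarrow> (nat \<Rightarrow> real) \<Rightarrow> real" where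
  "l1_dist N x y = (\<Sum>i<N. \<bar>x i - y i\<bar>)"

definition contains_scaled_cube :: "nat \<Rightarrow> nat \<Rightarrow> (nat \<Rightarrow> real) set \<Rightarrow> bool" where
  "contains_scaled_cube k N D \<longleftrightarrow>
     (\<exists>(r::real) > 0. \<exists>f \<in> cube k \<rightarrow> D. \<forall>x\<in>cube k. \<forall>y\<in>cube k.
        l1_dist N (f x) (f y) = r * l1_dist k x y)"

text \<open>
  \<open>Emb1 \<delta> k\<close> is Emb(1, \<open>\<delta>\<close>, k): the leading 1 says that the embedding preserves distances
  exactly up to the scaling factor r.  For \<open>\<delta> > 0\<close> some N has the required property (scale r = 2
  already suffices for N large), so the least one is well defined.
\<close>

definition Emb1 :: "real \<Rightarrow> nat \<Rightarrow> nat" where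
  "Emb1 \<delta> k = (LEAST N. \<forall>D \<subseteq> cube N.
     real (card D) \<ge> \<delta> * 2 ^ N \<longrightarrow> contains_scaled_cube k N D)"

end

theory Submission
  imports Defs "HOL-Library.Disjoint_Sets"
begin

text \<open>
  Encode the cube as the power set of its coordinates, so that the distance is the size of the
  symmetric difference.  A scaled isometric copy of the k-cube preserves betweenness coordinatewise;
  hence every coordinate of the image is either constant or copies (up to negation) a single
  coordinate of the k-cube.  So there are at most \<open>2^N (k+1)^N\<close> such copies, each with \<open>2^k\<close> points,
  and a union bound over all sets of size \<open>\<lceil>\<delta> 2^N\<rceil>\<close> yields one containing none of them when N is
  small.

  As the embedding number is a \<open>LEAST\<close>, some N with the embedding property must be exhibited as well.
  For this, flip single coordinates: among many translates of a dense set D by unit vectors two must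
  have a dense intersection E, and a (k-1)-cube with scale 2 in E, avoiding the two coordinates
  involved, extends to a k-cube with scale 2 in D.
\<close>

section \<open>The cube as a power set\<close>

text \<open>The restriction makes the indicator vector \<open>undefined\<close> outside
  \<open>{..<N}\<close>, as the extensional \<open>cube N\<close> demands. So every
  \<open>S\<close>, bounded or not, yields a point of the cube.\<close>

definition cube_point :: "nat \<Rightarrow> nat set \<Rightarrow> nat \<Rightarrow> real" where
  "cube_point N S = (\<lambda>i\<in>{..<N}. of_bool (i \<in> S))"

lemma cube_point_in_cube: "cube_point N S \<in> cube N"
  by (auto simp: cube_point_def cube_def)

lemma cube_point_support: "x \<in> cube N \<Longrightarrow> cube_point N {i. i < N \<and> x i = 1} = x"
  by (rule ext) (auto simp: cube_point_def cube_def PiE_iff extensional_def)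

lemma support_cube_point: "S \<subseteq> {..<N} \<Longrightarrow> {i. i < N \<and> cube_point N S i = 1} = S"
  by (auto simp: cube_point_def)

lemma inj_on_cube_point: "inj_on (cube_point N) (Pow {..<N})"
  by (rule inj_on_inverseI[where g = "\<lambda>x. {i. i < N \<and> x i = 1}"]) (simp add: support_cube_point)

lemma l1_dist_cube_point:
  assumes "S \<subseteq> {..<N}" "T \<subseteq> {..<N}"
  shows "l1_dist N (cube_point N S) (cube_point N T) = card (sym_diff S T)"
proof -
  have "l1_dist N (cube_point N S) (cube_point N T) = (\<Sum>i<N. of_bool (i \<in> sym_diff S T))"
    unfolding l1_dist_def by (rule sum.cong) (auto simp: cube_point_def)
  also have "\<dots> = card ({..<N} \<inter> sym_diff S T)"
    by (simp only: sum_of_bool_eq finite_lessThan Collect_mem_eq)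
  also have "{..<N} \<inter> sym_diff S T = sym_diff S T"
    using assms by auto
  finally show ?thesis .
qed

lemma subset_cube_image:
  assumes "D \<subseteq> cube N"
  obtains \<D> where "\<D> \<subseteq> Pow {..<N}" "D = cube_point N ` \<D>"
proof
  let ?supp = "\<lambda>x :: nat \<Rightarrow> real. {i. i < N \<and> x i = 1}"
  show "?supp ` D \<subseteq> Pow {..<N}" by auto
  have "cube_point N ` ?supp ` D = (\<lambda>x. x) ` D"
    unfolding image_image using assms by (intro image_cong refl cube_point_support) auto
  then show "D = cube_point N ` ?supp ` D" by simp
qed

text \<open>Moves the embedding problem to set systems with the metric
  \<open>card (sym_diff S T)\<close>, the form in which both the counting and the existence argument
  treat it.\<close>

lemma contains_scaled_cube_iff:
  assumes "\<D> \<subseteq> Pow {..<N}"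
  shows "contains_scaled_cube k N (cube_point N ` \<D>) \<longleftrightarrow>
    (\<exists>(r::real)>0. \<exists>F \<in> Pow {..<k} \<rightarrow> \<D>. \<forall>S\<subseteq>{..<k}. \<forall>T\<subseteq>{..<k}.
       card (sym_diff (F S) (F T)) = r * card (sym_diff S T))" (is "?L \<longleftrightarrow> ?R")
proof
  assume ?L
  then obtain r f where r: "r > 0" and f: "f \<in> cube k \<rightarrow> cube_point N ` \<D>"
    and eq: "\<And>x y. x \<in> cube k \<Longrightarrow> y \<in> cube k \<Longrightarrow> l1_dist N (f x) (f y) = r * l1_dist k x y"
    unfolding contains_scaled_cube_def by blast
  define F where "F S = (SOME A. A \<in> \<D> \<and> f (cube_point k S) = cube_point N A)" for S
  have F: "F S \<in> \<D> \<and> f (cube_point k S) = cube_point N (F S)" for S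
  proof -
    have "f (cube_point k S) \<in> cube_point N ` \<D>"
      using f cube_point_in_cube by (rule funcset_mem)
    then have "\<exists>A. A \<in> \<D> \<and> f (cube_point k S) = cube_point N A" by auto
    then show ?thesis unfolding F_def by (rule someI_ex)
  qed
  have "card (sym_diff (F S) (F T)) = r * card (sym_diff S T)"
    if "S \<subseteq> {..<k}" "T \<subseteq> {..<k}" for S T
  proof -
    have "F S \<subseteq> {..<N}" "F T \<subseteq> {..<N}" using F assms by blast+
    then have "card (sym_diff (F S) (F T)) = l1_dist N (cube_point N (F S)) (cube_point N (F T))"
      by (simp add: l1_dist_cube_point)
    also have "\<dots> = r * card (sym_diff S T)"
      using eq[of "cube_point k S" "cube_point k T"] F that
      by (simp add: cube_point_in_cube l1_dist_cube_point)
    finally show ?thesis .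
  qed
  moreover have "F \<in> Pow {..<k} \<rightarrow> \<D>" using F by blast
  ultimately show ?R using r by blast
next
  assume ?R
  then obtain r :: real and F where r: "r > 0" and F: "F \<in> Pow {..<k} \<rightarrow> \<D>"
    and eq: "\<forall>S\<subseteq>{..<k}. \<forall>T\<subseteq>{..<k}. card (sym_diff (F S) (F T)) = r * card (sym_diff S T)"
    by (elim exE conjE bexE) (rule that)
  define f where "f x = cube_point N (F {i. i < k \<and> x i = 1})" for x :: "nat \<Rightarrow> real"
  have sub: "{i. i < k \<and> x i = 1} \<subseteq> {..<k}" for x :: "nat \<Rightarrow> real" by auto
  have Fsub: "F S \<subseteq> {..<N}" if "S \<subseteq> {..<k}" for S using F assms that by blast
  have "l1_dist N (f x) (f y) = r * l1_dist k x y" if "x \<in> cube k" "y \<in> cube k" for x y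
  proof -
    have "l1_dist N (f x) (f y)
        = r * card (sym_diff {i. i < k \<and> x i = 1} {i. i < k \<and> y i = 1})"
      unfolding f_def by (simp only: l1_dist_cube_point Fsub sub eq[rule_format])
    also have "\<dots> = r * l1_dist k (cube_point k {i. i < k \<and> x i = 1})
        (cube_point k {i. i < k \<and> y i = 1})"
      by (simp only: l1_dist_cube_point sub)
    finally show ?thesis using that by (simp add: cube_point_support)
  qed
  moreover have "f \<in> cube k \<rightarrow> cube_point N ` \<D>" using F sub by (auto simp: f_def Pi_iff)
  ultimately show ?L unfolding contains_scaled_cube_def using r by blast
qed

section \<open>Rigidity of scaled cubes\<close>

text \<open>Since \<open>sym_diff A C\<close> is contained in the union of
  \<open>sym_diff A B\<close> and \<open>sym_diff B C\<close>, equality in the triangle inequality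
  makes these two disjoint: no coordinate flips twice on the way from \<open>A\<close> through
  \<open>B\<close> to \<open>C\<close>.\<close>

lemma between_if_card_sym_diff:
  assumes "finite A" "finite B" "finite C"
    and "card (sym_diff A C) = card (sym_diff A B) + card (sym_diff B C)"
  shows "A \<inter> C \<subseteq> B" "B \<subseteq> A \<union> C"
proof -
  have "card (sym_diff A C) \<le> card (sym_diff A B \<union> sym_diff B C)"
    using assms by (intro card_mono) auto
  moreover have "card (sym_diff A B) + card (sym_diff B C)
      = card (sym_diff A B \<union> sym_diff B C) + card (sym_diff A B \<inter> sym_diff B C)"
    using assms by (intro card_Un_Int) auto
  ultimately have "card (sym_diff A B \<inter> sym_diff B C) = 0" using assms(4) by linarith
  then have "sym_diff A B \<inter> sym_diff B C = {}" using assms by simp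
  then show "A \<inter> C \<subseteq> B" "B \<subseteq> A \<union> C" by blast+
qed

text \<open>Scaling by \<open>r\<close> keeps equality in the triangle inequality, so
  \<open>F\<close> preserves betweenness, coordinate by coordinate. The label \<open>c j\<close> is
  the coordinate of the \<open>k\<close>-cube that \<open>j\<close> follows; the label
  \<open>k\<close>, which lies in no \<open>S \<subseteq> {..<k}\<close>, marks a constant
  coordinate.\<close>

lemma scaled_cube_rigid:
  fixes r :: real and k :: nat
  assumes V: "finite V" and F: "\<And>S. S \<subseteq> {..<k} \<Longrightarrow> F S \<subseteq> V"
    and eq: "\<And>S T. S \<subseteq> {..<k} \<Longrightarrow> T \<subseteq> {..<k} \<Longrightarrow>
      card (sym_diff (F S) (F T)) = r * card (sym_diff S T)"
  shows "\<exists>c \<in> V \<rightarrow>\<^sub>E {..k}. \<forall>S\<subseteq>{..<k}. F S = sym_diff (F {}) {j \<in> V. c j \<in> S}"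
proof -
  have fin: "finite (F S)" if "S \<subseteq> {..<k}" for S
    using F[OF that] V finite_subset by blast
  have btw: "F S \<inter> F U \<subseteq> F T \<and> F T \<subseteq> F S \<union> F U"
    if "S \<subseteq> {..<k}" "T \<subseteq> {..<k}" "U \<subseteq> {..<k}"
      and c: "card (sym_diff S U) = card (sym_diff S T) + card (sym_diff T U)" for S T U
  proof -
    have "real (card (sym_diff (F S) (F U)))
        = real (card (sym_diff (F S) (F T)) + card (sym_diff (F T) (F U)))"
      using that by (simp add: eq algebra_simps)
    then have "card (sym_diff (F S) (F U))
        = card (sym_diff (F S) (F T)) + card (sym_diff (F T) (F U))"
      by linarith
    with between_if_card_sym_diff[of "F S" "F T" "F U"] show ?thesis using fin that by blast
  qed
  \<comment> \<open>\<open>P j i\<close> means that \<open>j\<close> reacts to the flip of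
    \<open>i\<close> at the empty set. If such \<open>i\<close> exist, any of them may serve as the
    label.\<close>
  define P where "P j i \<longleftrightarrow> i < k \<and> (j \<in> F {i} \<longleftrightarrow> j \<notin> F {})" for j i
  define c where "c = (\<lambda>j\<in>V. if \<exists>i. P j i then SOME i. P j i else k)"
  have c_in: "c \<in> V \<rightarrow>\<^sub>E {..k}"
  proof -
    have "(SOME i. P j i) \<le> k" if "P j i" for i j
      using someI[of "P j", OF that] P_def[of j "SOME i. P j i"] by linarith
    then show ?thesis by (auto simp: c_def)
  qed
  have key: "j \<in> F S \<longleftrightarrow> (j \<in> F {} \<longleftrightarrow> c j \<notin> S)" if "S \<subseteq> {..<k}" "j \<in> V" for S j
  proof (cases "\<exists>i. P j i")
    case True
    define i where "i = c j"
    have i: "P j i" unfolding i_def c_def using True that by (simp add: someI_ex)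
    then have ik: "{i} \<subseteq> {..<k}" by (simp add: P_def)
    have finS: "finite S" using that finite_subset by blast
    show ?thesis
    proof (cases "i \<in> S")
      case True
      \<comment> \<open>\<open>{i}\<close> lies between \<open>{}\<close> and \<open>S\<close>:
        coordinate \<open>j\<close> has changed at \<open>{i}\<close> and cannot change back at
        \<open>S\<close>.\<close>
      have "card (sym_diff {} S) = card (sym_diff {} {i}) + card (sym_diff {i} S)"
      proof -
        have "sym_diff {i} S = S - {i}" using True by auto
        then show ?thesis using card.remove[OF finS True] by simp
      qed
      with btw[of "{}" "{i}" S] that ik i True show ?thesis unfolding i_def[symmetric] P_def by blast
    next
      case False
      \<comment> \<open>\<open>{}\<close> lies between \<open>S\<close> and \<open>{i}\<close>: as
        \<open>j\<close> changes from \<open>{}\<close> to \<open>{i}\<close>, it cannot have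
        changed from \<open>S\<close> to \<open>{}\<close>.\<close>
      have "card (sym_diff S {i}) = card (sym_diff S {}) + card (sym_diff {} {i})"
      proof -
        have "sym_diff S {i} = insert i S" using False by auto
        then show ?thesis using False finS by simp
      qed
      with btw[of S "{}" "{i}"] that ik i False show ?thesis unfolding i_def[symmetric] P_def by blast
    qed
  next
    case False
    then have cj: "c j = k" using that by (auto simp: c_def)
    have "finite S" using that finite_subset by blast
    \<comment> \<open>\<open>insert i S\<close> lies between \<open>{i}\<close> and
      \<open>S\<close>, and at both of them \<open>j\<close> has its value at \<open>{}\<close>; so
      it keeps this value in between.\<close>
    then have "S \<subseteq> {..<k} \<Longrightarrow> j \<in> F S \<longleftrightarrow> j \<in> F {}"
    proof (induction S rule: finite_induct)
      case (insert i S)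
      have "sym_diff {i} S = insert i S" "sym_diff {i} (insert i S) = S - {i}"
        "sym_diff (insert i S) S = {i}" "S - {i} = S"
        using insert.hyps by auto
      then have "card (sym_diff {i} S)
          = card (sym_diff {i} (insert i S)) + card (sym_diff (insert i S) S)"
        using insert.hyps by simp
      with btw[of "{i}" "insert i S" S] insert.prems
      have "F {i} \<inter> F S \<subseteq> F (insert i S)" "F (insert i S) \<subseteq> F {i} \<union> F S" by auto
      moreover have "j \<in> F {i} \<longleftrightarrow> j \<in> F {}" using False insert.prems by (auto simp: P_def)
      ultimately show ?case using insert.IH insert.prems by blast
    qed simp
    then show ?thesis using that cj by auto
  qed
  have "F S = sym_diff (F {}) {j \<in> V. c j \<in> S}" if "S \<subseteq> {..<k}" for S
    using key[OF that] F[OF that] F[of "{}"] by blast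
  with c_in show ?thesis by blast
qed

section \<open>Dense sets without scaled cubes\<close>

text \<open>The quotient of the two binomials is the product of \<open>(m - i) / (M - i)\<close>
  over \<open>i < s\<close>, and each factor is at most \<open>m / M\<close>. It is the probability
  that a random \<open>m\<close>-subset of an \<open>M\<close>-set contains a given
  \<open>s\<close>-subset.\<close>

lemma binomial_shift_le:
  assumes "s \<le> m" "m \<le> M"
  shows "((M - s) choose (m - s)) * M ^ s \<le> (M choose m) * m ^ s"
  using assms(1)
proof (induction s)
  case (Suc s)
  have step: "((M - Suc s) choose (m - Suc s)) * (M - s) = ((M - s) choose (m - s)) * (m - s)"
    using Suc_times_binomial_eq[of "M - Suc s" "m - Suc s"] Suc.prems assms(2)
    by (simp add: Suc_diff_Suc mult.commute)
  have le: "(m - s) * M \<le> m * (M - s)"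
    using assms(2) by (simp add: diff_mult_distrib diff_mult_distrib2 mult.commute diff_le_mono2)
  \<comment> \<open>To avoid division, the inequality is proved with the extra factor
    \<open>M - s\<close>, which is positive because \<open>Suc s \<le> m \<le> M\<close> and is
    cancelled at the end.\<close>
  have "((M - Suc s) choose (m - Suc s)) * M ^ Suc s * (M - s)
      = (((M - Suc s) choose (m - Suc s)) * (M - s)) * M ^ s * M"
    by (simp only: power_Suc mult_ac)
  also have "\<dots> = ((M - s) choose (m - s)) * M ^ s * ((m - s) * M)"
    unfolding step by (simp only: mult_ac)
  also have "\<dots> \<le> ((M - s) choose (m - s)) * M ^ s * (m * (M - s))"
    using le by (rule mult_le_mono2)
  also have "\<dots> \<le> (M choose m) * m ^ s * (m * (M - s))"
    using Suc by (intro mult_le_mono1) auto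
  finally show ?case using Suc.prems assms(2) by (simp add: mult_ac)
qed simp

lemma card_supersets:
  assumes "finite X" "A \<subseteq> X" "card A \<le> m"
  shows "card {D. D \<subseteq> X \<and> card D = m \<and> A \<subseteq> D} = (card X - card A) choose (m - card A)"
proof -
  have finA: "finite A" using assms finite_subset by blast
  have "bij_betw (\<lambda>E. A \<union> E) {E. E \<subseteq> X - A \<and> card E = m - card A}
      {D. D \<subseteq> X \<and> card D = m \<and> A \<subseteq> D}"
  proof (rule bij_betw_byWitness[where f' = "\<lambda>D. D - A"])
    show "(\<lambda>E. A \<union> E) ` {E. E \<subseteq> X - A \<and> card E = m - card A}
        \<subseteq> {D. D \<subseteq> X \<and> card D = m \<and> A \<subseteq> D}"
    proof clarify
      fix E assume E: "E \<subseteq> X - A" "card E = m - card A"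
      have "card (A \<union> E) = card A + card E"
        using E assms finA finite_subset[of E X] by (intro card_Un_disjoint) auto
      then show "A \<union> E \<subseteq> X \<and> card (A \<union> E) = m \<and> A \<subseteq> A \<union> E" using E assms by auto
    qed
    show "(\<lambda>D. D - A) ` {D. D \<subseteq> X \<and> card D = m \<and> A \<subseteq> D}
        \<subseteq> {E. E \<subseteq> X - A \<and> card E = m - card A}"
      using finA by (auto simp: card_Diff_subset)
  qed auto
  then have "card {D. D \<subseteq> X \<and> card D = m \<and> A \<subseteq> D}
      = card {E. E \<subseteq> X - A \<and> card E = m - card A}"
    by (simp add: bij_betw_same_card)
  also have "\<dots> = card (X - A) choose (m - card A)"
    using assms(1) by (intro n_subsets) simp
  finally show ?thesis using finA assms(2) by (simp add: card_Diff_subset)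
qed

text \<open>Union bound: a random \<open>m\<close>-subset contains a given member of
  \<open>Q\<close> with probability at most \<open>(m / card X) ^ s\<close>, so by
  \<open>less\<close> it contains some member with probability below 1. The proof counts pairs
  instead.\<close>

lemma exists_subset_avoiding_family:
  assumes X: "finite X" and Q: "finite Q" "\<And>A. A \<in> Q \<Longrightarrow> A \<subseteq> X \<and> card A = s"
    and m: "s \<le> m" "m \<le> card X" and less: "card Q * m ^ s < card X ^ s"
  shows "\<exists>D\<subseteq>X. card D = m \<and> (\<forall>A\<in>Q. \<not> A \<subseteq> D)"
proof (rule ccontr)
  assume neg: "\<not> ?thesis"
  let ?M = "card X"
  have "?M choose m = card {D. D \<subseteq> X \<and> card D = m}"
    using X by (simp add: n_subsets)
  also have "\<dots> \<le> card (\<Union>A\<in>Q. {D. D \<subseteq> X \<and> card D = m \<and> A \<subseteq> D})"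
  proof (rule card_mono)
    show "finite (\<Union>A\<in>Q. {D. D \<subseteq> X \<and> card D = m \<and> A \<subseteq> D})"
      using X by (intro finite_subset[OF _ finite_Pow_iff[THEN iffD2, OF X]]) auto
    show "{D. D \<subseteq> X \<and> card D = m} \<subseteq> (\<Union>A\<in>Q. {D. D \<subseteq> X \<and> card D = m \<and> A \<subseteq> D})"
      using neg by blast
  qed
  also have "\<dots> \<le> (\<Sum>A\<in>Q. card {D. D \<subseteq> X \<and> card D = m \<and> A \<subseteq> D})"
    by (rule card_UN_le) (rule Q)
  also have "\<dots> = (\<Sum>A\<in>Q. (?M - s) choose (m - s))"
    using Q(2) X m by (intro sum.cong refl) (auto simp: card_supersets)
  finally have "?M choose m \<le> card Q * ((?M - s) choose (m - s))" by simp
  then have "(?M choose m) * ?M ^ s \<le> card Q * (((?M - s) choose (m - s)) * ?M ^ s)"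
    by (metis mult.assoc mult_le_mono1)
  also have "\<dots> \<le> card Q * ((?M choose m) * m ^ s)"
    using m by (intro mult_le_mono2 binomial_shift_le)
  also have "\<dots> = (?M choose m) * (card Q * m ^ s)" by (simp add: mult_ac)
  also have "\<dots> < (?M choose m) * ?M ^ s"
    using less m by simp
  finally show False by simp
qed

text \<open>By rigidity the image of a scaled cube is determined by its base set and its labelling,
  which leaves at most \<open>2 ^ N * (k + 1) ^ N\<close> sets to avoid.\<close>

lemma exists_subset_without_scaled_cube:
  assumes m: "m \<le> 2 ^ N" "0 < m"
    and less: "2 ^ k \<le> m \<Longrightarrow> 2 ^ N * (k + 1) ^ N * m ^ (2 ^ k) < (2 ^ N) ^ (2 ^ k)"
  shows "\<exists>D\<subseteq>cube N. card D = m \<and> \<not> contains_scaled_cube k N D"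
proof -
  \<comment> \<open>\<open>a\<close> is the base set \<open>F {}\<close> and \<open>c\<close> the
    labelling. Labellings that miss a coordinate give fewer than \<open>2 ^ k\<close> points and are
    filtered out, as the union bound wants sets of one size.\<close>
  define Q where "Q = {A \<in> (\<lambda>(a, c). (\<lambda>S. sym_diff a {j \<in> {..<N}. c j \<in> S}) ` Pow {..<k}) `
    (Pow {..<N} \<times> ({..<N} \<rightarrow>\<^sub>E {..k})). A \<subseteq> Pow {..<N} \<and> card A = 2 ^ k}"
  have fin: "finite (Pow {..<N} \<times> ({..<N} \<rightarrow>\<^sub>E {..k}))"
    by (intro finite_cartesian_product finite_PiE) auto
  then have finQ: "finite Q" unfolding Q_def by simp
  have "card Q \<le> card (Pow {..<N} \<times> ({..<N} \<rightarrow>\<^sub>E {..k}))"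
    unfolding Q_def
    by (rule order_trans[OF card_mono card_image_le]) (use fin in auto)
  also have "\<dots> = 2 ^ N * (k + 1) ^ N"
    by (simp add: card_cartesian_product card_Pow card_PiE)
  finally have cardQ: "card Q \<le> 2 ^ N * (k + 1) ^ N" .
  have "\<exists>\<D>\<subseteq>Pow {..<N}. card \<D> = m \<and> (\<forall>A\<in>Q. \<not> A \<subseteq> \<D>)"
  proof (cases "2 ^ k \<le> m")
    case True
    have "card Q * m ^ (2 ^ k) < (2 ^ N) ^ (2 ^ k)"
      using less[OF True] mult_le_mono1[OF cardQ] order_le_less_trans by blast
    then show ?thesis
      using finQ m True by (intro exists_subset_avoiding_family[where s = "2 ^ k"])
        (auto simp: Q_def card_Pow)
  next
    case False
    \<comment> \<open>A set of fewer than \<open>2 ^ k\<close> points is too small to contain a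
      member of \<open>Q\<close>, so any choice works.\<close>
    obtain \<D> where \<D>: "\<D> \<subseteq> Pow {..<N}" "card \<D> = m"
      using m(1) obtain_subset_with_card_n[of m "Pow {..<N}"] by (auto simp: card_Pow)
    have "finite \<D>" using \<D> finite_subset by blast
    then have "\<not> A \<subseteq> \<D>" if "A \<in> Q" for A
      using that card_mono[of \<D> A] False \<D> by (auto simp: Q_def)
    with \<D> show ?thesis by blast
  qed
  then obtain \<D> where \<D>: "\<D> \<subseteq> Pow {..<N}" "card \<D> = m" and avoid: "\<And>A. A \<in> Q \<Longrightarrow> \<not> A \<subseteq> \<D>"
    by blast
  have "\<not> contains_scaled_cube k N (cube_point N ` \<D>)"
  proof
    assume "contains_scaled_cube k N (cube_point N ` \<D>)"
    then obtain r :: real and F where r: "r > 0" and F: "F \<in> Pow {..<k} \<rightarrow> \<D>"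
      and eq: "\<forall>S\<subseteq>{..<k}. \<forall>T\<subseteq>{..<k}. card (sym_diff (F S) (F T)) = r * card (sym_diff S T)"
      unfolding contains_scaled_cube_iff[OF \<D>(1)] by (elim exE conjE bexE) (rule that)
    have FN: "F S \<subseteq> {..<N}" if "S \<subseteq> {..<k}" for S using F \<D> that by blast
    obtain c where c: "c \<in> {..<N} \<rightarrow>\<^sub>E {..k}"
      "\<And>S. S \<subseteq> {..<k} \<Longrightarrow> F S = sym_diff (F {}) {j \<in> {..<N}. c j \<in> S}"
      using scaled_cube_rigid[OF finite_lessThan FN eq[rule_format]] by blast
    have "inj_on F (Pow {..<k})"
    proof (rule inj_onI)
      fix S T assume ST: "S \<in> Pow {..<k}" "T \<in> Pow {..<k}" "F S = F T"
      then have "real (card (sym_diff S T)) = 0" using eq[rule_format, of S T] r by simp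
      moreover have "finite (sym_diff S T)"
        using ST finite_subset[of _ "{..<k}"] by auto
      ultimately show "S = T" by auto
    qed
    then have "card (F ` Pow {..<k}) = 2 ^ k" by (simp add: card_image card_Pow)
    moreover have "F ` Pow {..<k} = (\<lambda>S. sym_diff (F {}) {j \<in> {..<N}. c j \<in> S}) ` Pow {..<k}"
      by (rule image_cong[OF refl], rule c(2)) simp
    moreover have "F ` Pow {..<k} \<subseteq> Pow {..<N}" using FN by auto
    ultimately have "F ` Pow {..<k} \<in> Q"
      unfolding Q_def using c(1) FN[of "{}"]
      by (auto intro!: rev_image_eqI[of "(F {}, c)"])
    moreover have "F ` Pow {..<k} \<subseteq> \<D>" using F by auto
    ultimately show False using avoid by blast
  qed
  moreover have "cube_point N ` \<D> \<subseteq> cube N" by (auto simp: cube_point_in_cube)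
  moreover have "card (cube_point N ` \<D>) = m"
    using \<D> inj_on_subset[OF inj_on_cube_point] by (auto simp: card_image)
  ultimately show ?thesis by blast
qed

section \<open>Scaled cubes in dense sets of large dimension\<close>

text \<open>A truncated inclusion-exclusion: each new set meets the union of the earlier ones in at
  most \<open>card I * e\<close> points, and these overlaps add up to at most
  \<open>(card I)\<^sup>2 * e\<close>.\<close>

lemma sum_card_le_card_UN_plus:
  fixes e :: real
  assumes "finite I" and "\<And>i. i \<in> I \<Longrightarrow> finite (T i)"
    and "\<And>i j. i \<in> I \<Longrightarrow> j \<in> I \<Longrightarrow> i \<noteq> j \<Longrightarrow> card (T i \<inter> T j) \<le> e" and "0 \<le> e"
  shows "(\<Sum>i\<in>I. real (card (T i))) \<le> card (\<Union>i\<in>I. T i) + (card I)\<^sup>2 * e"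
  using assms(1-3)
proof (induction I rule: finite_induct)
  case (insert i I)
  let ?U = "\<Union>j\<in>I. T j"
  have "card (T i \<inter> ?U) \<le> (\<Sum>j\<in>I. card (T i \<inter> T j))"
    using card_UN_le[OF insert.hyps(1), of "\<lambda>j. T i \<inter> T j"] by simp
  then have "real (card (T i \<inter> ?U)) \<le> (\<Sum>j\<in>I. real (card (T i \<inter> T j)))"
    by (metis of_nat_le_iff of_nat_sum)
  also have "\<dots> \<le> (\<Sum>j\<in>I. e)"
    using insert by (intro sum_mono) auto
  finally have le: "real (card (T i \<inter> ?U)) \<le> card I * e" by simp
  have "card (T i) + card ?U = card (T i \<union> ?U) + card (T i \<inter> ?U)"
    using insert by (intro card_Un_Int) auto
  then have "real (card (T i)) + card ?U = card (T i \<union> ?U) + card (T i \<inter> ?U)"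
    by linarith
  moreover have "(\<Sum>i\<in>I. real (card (T i))) \<le> card ?U + (card I)\<^sup>2 * e"
    using insert by auto
  moreover have "(card I)\<^sup>2 * e + card I * e \<le> (Suc (card I))\<^sup>2 * e"
    using \<open>0 \<le> e\<close> by (simp add: power2_eq_square algebra_simps)
  ultimately show ?case using insert.hyps le by simp
qed simp

text \<open>The sizes sum to at least \<open>2 * card X\<close>, the union has at most
  \<open>card X\<close> points. If all pairwise overlaps were below the stated bound, they would
  account for only \<open>card X / 2\<close>.\<close>

lemma exists_dense_intersection:
  fixes \<delta> :: real
  assumes X: "finite X" "X \<noteq> {}" and I: "finite I" "2 \<le> \<delta> * card I"
    and T: "\<And>i. i \<in> I \<Longrightarrow> T i \<subseteq> X \<and> \<delta> * card X \<le> card (T i)"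
  shows "\<exists>i\<in>I. \<exists>j\<in>I. i \<noteq> j \<and> 1 / (2 * (card I)\<^sup>2) * card X \<le> card (T i \<inter> T j)"
proof (rule ccontr)
  assume neg: "\<not> ?thesis"
  let ?e = "1 / (2 * (card I)\<^sup>2) * card X"
  have I0: "card I \<noteq> 0" using I by auto
  have X0: "0 < card X" using X by auto
  have "2 * real (card X) \<le> (\<delta> * card I) * card X"
    using I by (intro mult_right_mono) auto
  also have "\<dots> = (\<Sum>i\<in>I. \<delta> * card X)" by simp
  also have "\<dots> \<le> (\<Sum>i\<in>I. real (card (T i)))"
    using T by (intro sum_mono) auto
  also have "\<dots> \<le> card (\<Union>i\<in>I. T i) + (card I)\<^sup>2 * ?e"
  proof (rule sum_card_le_card_UN_plus)
    show "finite (T i)" if "i \<in> I" for i using T[OF that] X finite_subset by blast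
    show "real (card (T i \<inter> T j)) \<le> ?e" if "i \<in> I" "j \<in> I" "i \<noteq> j" for i j
      using neg that by force
  qed (use I in auto)
  also have "real (card (\<Union>i\<in>I. T i)) \<le> card X"
    using T X by (simp add: UN_least card_mono)
  also have "(card I)\<^sup>2 * ?e = card X / 2" using I0 by simp
  finally show False using X0 by simp
qed

text \<open>A cube of scale 2: each of its directions flips a pair of coordinates, and the pairs are
  disjoint. \<open>U\<close> holds the coordinates that may be flipped; \<open>D\<close> may involve
  others.\<close>

definition contains_pair_flip_cube :: "nat \<Rightarrow> 'a set \<Rightarrow> 'a set set \<Rightarrow> bool" where
  "contains_pair_flip_cube k U D \<longleftrightarrow>
     (\<exists>a B. (\<forall>i<k. B i \<subseteq> U \<and> card (B i) = 2) \<and> disjoint_family_on B {..<k} \<and>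
       (\<forall>S\<subseteq>{..<k}. sym_diff a (\<Union>i\<in>S. B i) \<in> D))"

text \<open>Induction on \<open>k\<close>, for all densities at once since each step lowers the
  density. Keeping \<open>U\<close> apart from \<open>V\<close> reserves coordinates for a new
  direction while the density is still measured in the same cube \<open>Pow V\<close>.\<close>

lemma exists_pair_flip_cube:
  fixes \<delta> :: real and k :: nat
  assumes "0 < \<delta>"
  shows "\<exists>n. \<forall>(V :: 'a set) U D. finite V \<longrightarrow> U \<subseteq> V \<longrightarrow> n \<le> card U \<longrightarrow> D \<subseteq> Pow V \<longrightarrow>
      \<delta> * 2 ^ card V \<le> card D \<longrightarrow>
      contains_pair_flip_cube k U D"
  using assms
proof (induction k arbitrary: \<delta>)
  case 0
  have "\<exists>a. a \<in> D" if "\<delta> * 2 ^ card V \<le> card D" for V :: "'a set" and D :: "'a set set"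
  proof -
    have "0 < \<delta> * 2 ^ card V" using 0 by simp
    with that have "card D \<noteq> 0" by linarith
    then have "D \<noteq> {}" by auto
    then show ?thesis by blast
  qed
  then show ?case by (simp add: contains_pair_flip_cube_def disjoint_family_on_def)
next
  case (Suc k)
  \<comment> \<open>Enough translates of density \<delta> for
    \<open>exists_dense_intersection\<close>, which asks for
    \<open>2 \<le> \<delta> * p\<close>.\<close>
  define p where "p = nat \<lceil>2 / \<delta>\<rceil>"
  have p: "2 \<le> \<delta> * p"
  proof -
    have "2 / \<delta> \<le> p" unfolding p_def by linarith
    then show ?thesis using Suc.prems by (simp add: field_simps)
  qed
  then have "0 < p" by (cases p) auto
  then have "0 < 1 / (2 * (real p)\<^sup>2)" by simp
  from Suc.IH[OF this]
  obtain n where n: "\<And>(V :: 'a set) U E. finite V \<Longrightarrow> U \<subseteq> V \<Longrightarrow> n \<le> card U \<Longrightarrow>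
      E \<subseteq> Pow V \<Longrightarrow> 1 / (2 * (real p)\<^sup>2) * 2 ^ card V \<le> card E \<Longrightarrow>
      contains_pair_flip_cube k U E"
    by blast
  \<comment> \<open>\<open>p\<close> coordinates supply the translates, and \<open>n\<close> remain
    for the induction hypothesis.\<close>
  show ?case
  proof (intro exI[of _ "p + n"] allI impI)
    fix V U :: "'a set" and D
    assume V: "finite V" and U: "U \<subseteq> V" "p + n \<le> card U" and D: "D \<subseteq> Pow V"
      and dens: "\<delta> * 2 ^ card V \<le> card D"
    obtain I where I: "I \<subseteq> U" "card I = p" "finite I"
      using U obtain_subset_with_card_n[of p U] by auto
    have nU: "n \<le> card (U - I)" using I U by (simp add: card_Diff_subset)
    \<comment> \<open>The translate of \<open>D\<close> by the unit vector \<open>i\<close>.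
      Flipping is an involution, so membership of \<open>x\<close> in \<open>T i\<close> puts
      \<open>sym_diff x {i}\<close> into \<open>D\<close>.\<close>
    define T where "T i = (\<lambda>x. sym_diff x {i}) ` D" for i
    have T_sub: "T i \<subseteq> Pow V" if "i \<in> I" for i
    proof -
      have "i \<in> V" using that I U by blast
      then show ?thesis using D by (auto simp: T_def)
    qed
    have T_card: "card (T i) = card D" for i
      unfolding T_def
      by (intro card_image inj_on_inverseI[where g = "\<lambda>x. sym_diff x {i}"]) auto
    have T_mem: "sym_diff x {i} \<in> D" if x: "x \<in> T i" for x i
    proof -
      obtain y where y: "y \<in> D" "x = sym_diff y {i}" using x by (auto simp: T_def)
      then have "sym_diff x {i} = y" by auto
      with y show ?thesis by simp
    qed
    have "\<exists>i\<in>I. \<exists>j\<in>I. i \<noteq> j \<and> 1 / (2 * (card I)\<^sup>2) * card (Pow V) \<le> card (T i \<inter> T j)"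
      by (rule exists_dense_intersection[where \<delta> = \<delta>])
        (use V I p T_sub T_card dens in \<open>auto simp: card_Pow\<close>)
    then obtain i j where ij: "i \<in> I" "j \<in> I" "i \<noteq> j"
      and E: "1 / (2 * (real p)\<^sup>2) * 2 ^ card V \<le> card (T i \<inter> T j)"
      using I V by (auto simp: card_Pow)
    have "U - I \<subseteq> V" "T i \<inter> T j \<subseteq> Pow V" using U T_sub[OF ij(1)] by blast+
    from n[OF V this(1) nU this(2) E] obtain a B
      where B_all: "\<forall>l<k. B l \<subseteq> U - I \<and> card (B l) = 2"
        and disj: "disjoint_family_on B {..<k}"
        and mem_all: "\<forall>S\<subseteq>{..<k}. sym_diff a (\<Union>l\<in>S. B l) \<in> T i \<inter> T j"
      unfolding contains_pair_flip_cube_def by (elim exE conjE) (rule that)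
    note B = B_all[rule_format] and mem = mem_all[rule_format]
    define B' where "B' = B(k := {i, j})"
    \<comment> \<open>The new base is \<open>a\<close> with \<open>i\<close> flipped. Without
      direction \<open>k\<close> the point is an element of \<open>T i\<close> flipped at
      \<open>i\<close>; with it, flipping \<open>i\<close> and \<open>j\<close> leaves an element of
      \<open>T j\<close> flipped at \<open>j\<close>. Both lie in \<open>D\<close>.\<close>
    have "sym_diff (sym_diff a {i}) (\<Union>l\<in>S. B' l) \<in> D" if S: "S \<subseteq> {..<Suc k}" for S
    proof -
      let ?S = "S - {k}"
      have sub: "?S \<subseteq> {..<k}" using S by (auto simp: less_Suc_eq)
      let ?W = "\<Union>l\<in>?S. B l"
      have W: "i \<notin> ?W" "j \<notin> ?W" using sub B ij by blast+
      have W': "(\<Union>l\<in>?S. B' l) = ?W" by (auto simp: B'_def)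
      show ?thesis
      proof (cases "k \<in> S")
        case True
        then have "S = insert k ?S" by auto
        then have "(\<Union>l\<in>S. B' l) = {i, j} \<union> ?W"
          using W' by (metis B'_def UN_insert fun_upd_same)
        moreover have "sym_diff (sym_diff a {i}) ({i, j} \<union> ?W) = sym_diff (sym_diff a ?W) {j}"
          using W ij(3) by auto
        ultimately show ?thesis using T_mem mem[OF sub] by simp
      next
        case False
        then have "(\<Union>l\<in>S. B' l) = ?W" using W' by simp
        moreover have "sym_diff (sym_diff a {i}) ?W = sym_diff (sym_diff a ?W) {i}"
          using W by auto
        ultimately show ?thesis using T_mem mem[OF sub] by simp
      qed
    qed
    moreover have "\<forall>l<Suc k. B' l \<subseteq> U \<and> card (B' l) = 2"
      using B ij I by (auto simp: B'_def less_Suc_eq)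
    moreover have "disjoint_family_on B' {..<Suc k}"
    proof -
      have "B l \<inter> {i, j} = {}" if "l < k" for l using B[OF that] ij by blast
      then show ?thesis using disj
        by (fastforce simp: disjoint_family_on_def B'_def less_Suc_eq)
    qed
    ultimately show "contains_pair_flip_cube (Suc k) U D"
      unfolding contains_pair_flip_cube_def by blast
  qed
qed

text \<open>Makes the \<open>LEAST\<close> in \<open>Emb1\<close> meaningful. All of
  \<open>{..<N}\<close> may be flipped, and disjoint pairs yield the scale 2.\<close>

lemma exists_dimension_containing_scaled_cube:
  fixes \<delta> :: real
  assumes "0 < \<delta>"
  shows "\<exists>N. \<forall>D \<subseteq> cube N. real (card D) \<ge> \<delta> * 2 ^ N \<longrightarrow> contains_scaled_cube k N D"
proof -
  obtain N :: nat where N: "\<And>V U :: nat set. \<And>D. finite V \<Longrightarrow> U \<subseteq> V \<Longrightarrow> N \<le> card U \<Longrightarrow>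
      D \<subseteq> Pow V \<Longrightarrow> \<delta> * 2 ^ card V \<le> card D \<Longrightarrow>
      contains_pair_flip_cube k U D"
    using exists_pair_flip_cube[OF assms, of k] by blast
  have "contains_scaled_cube k N D" if D: "D \<subseteq> cube N" "real (card D) \<ge> \<delta> * 2 ^ N" for D
  proof -
    obtain \<D> where \<D>: "\<D> \<subseteq> Pow {..<N}" "D = cube_point N ` \<D>"
      using subset_cube_image[OF D(1)] by blast
    have "card D = card \<D>"
      unfolding \<D>(2) by (intro card_image inj_on_subset[OF inj_on_cube_point] \<D>)
    then have "\<delta> * 2 ^ card {..<N} \<le> card \<D>" using D by simp
    then have "contains_pair_flip_cube k {..<N} \<D>" using N[of "{..<N}" "{..<N}" \<D>] \<D>(1) by simp
    then obtain a B
      where B: "\<forall>i<k. B i \<subseteq> {..<N} \<and> card (B i) = 2" and disj: "disjoint_family_on B {..<k}"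
        and mem: "\<forall>S\<subseteq>{..<k}. sym_diff a (\<Union>i\<in>S. B i) \<in> \<D>"
      unfolding contains_pair_flip_cube_def by (elim exE conjE) (rule that)
    define F where "F S = sym_diff a (\<Union>i\<in>S. B i)" for S
    have "real (card (sym_diff (F S) (F T))) = 2 * card (sym_diff S T)"
      if "S \<subseteq> {..<k}" "T \<subseteq> {..<k}" for S T
    proof -
      have "sym_diff (F S) (F T) = sym_diff (\<Union>i\<in>S. B i) (\<Union>i\<in>T. B i)"
        unfolding F_def by auto
      \<comment> \<open>Each coordinate lies in at most one pair, so the union over pairs commutes
        with the symmetric difference.\<close>
      also have "\<dots> = (\<Union>i\<in>sym_diff S T. B i)"
      proof (rule set_eqI)
        fix x
        show "x \<in> sym_diff (\<Union>i\<in>S. B i) (\<Union>i\<in>T. B i) \<longleftrightarrow> x \<in> (\<Union>i\<in>sym_diff S T. B i)"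
        proof (cases "\<exists>i<k. x \<in> B i")
          case True
          then obtain i where i: "i < k" "x \<in> B i" by blast
          have "x \<in> (\<Union>j\<in>R. B j) \<longleftrightarrow> i \<in> R" if "R \<subseteq> {..<k}" for R
          proof
            assume "x \<in> (\<Union>j\<in>R. B j)"
            then obtain j where j: "j \<in> R" "x \<in> B j" by blast
            with i that disj have "i = j" unfolding disjoint_family_on_def by blast
            with j show "i \<in> R" by simp
          qed (use i in blast)
          from this[of S] this[of T] this[of "sym_diff S T"] that show ?thesis by auto
        next
          case False
          with that show ?thesis by blast
        qed
      qed
      also have "card \<dots> = (\<Sum>i\<in>sym_diff S T. card (B i))"
      proof (rule card_UN_disjoint)
        show "finite (sym_diff S T)" using that finite_subset[of _ "{..<k}"] by auto
        show "\<forall>i\<in>sym_diff S T. finite (B i)"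
          using that B by (auto intro!: card_ge_0_finite)
        show "\<forall>i\<in>sym_diff S T. \<forall>j\<in>sym_diff S T. i \<noteq> j \<longrightarrow> B i \<inter> B j = {}"
          using disj that unfolding disjoint_family_on_def by blast
      qed
      also have "\<dots> = (\<Sum>i\<in>sym_diff S T. 2)"
        using that B by (intro sum.cong) auto
      finally show ?thesis by simp
    qed
    moreover have "F \<in> Pow {..<k} \<rightarrow> \<D>" using mem by (auto simp: F_def)
    ultimately show ?thesis
      unfolding \<D>(2) contains_scaled_cube_iff[OF \<D>(1)]
      by (intro exI[of _ 2] conjI bexI[of _ F]) auto
  qed
  then show ?thesis by blast
qed

section \<open>The lower bound\<close>

text \<open>Bounding \<open>m\<close> by \<open>sqrt \<delta> * 2 ^ N\<close> and
  \<open>2 * (k + 1)\<close> by \<open>k * k\<close> reduces the claim to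
  \<open>k ^ (2 * N) < (1 / sqrt \<delta>) ^ (2 ^ k)\<close>. In logarithms this asks for a constant
  of at most 1/4 in the bound on \<open>N\<close>, and 1/5 is smaller.\<close>

lemma cube_copies_count_less:
  fixes \<delta> :: real
  assumes k: "4 \<le> k" and \<delta>: "0 < \<delta>" "\<delta> < 1 / 2"
    and N: "real N < 1 / 5 * (2 ^ k * log 2 (1 / \<delta>) / log 2 (real k))"
    and m: "2 ^ k \<le> m" "real m \<le> \<delta> * 2 ^ N + 1"
  shows "2 ^ N * (k + 1) ^ N * m ^ (2 ^ k) < (2 ^ N) ^ (2 ^ k)"
proof -
  define s :: nat where "s = 2 ^ k"
  have "(2::nat) ^ 4 \<le> 2 ^ k" using k by (intro power_increasing) auto
  then have s16: "16 \<le> s" by (simp add: s_def)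
  have sq: "sqrt \<delta> \<le> 15 / 16"
  proof (rule real_le_lsqrt)
    show "\<delta> \<le> (15 / 16)\<^sup>2" using \<delta> by (simp add: power2_eq_square)
  qed (use \<delta> in auto)
  \<comment> \<open>As \<open>m \<ge> 16\<close>, the rounding term 1 is at most
    \<open>m / 16\<close>. Half of the power of \<delta> is then spent on absorbing the factor
    16/15.\<close>
  have "real m \<le> 16 / 15 * (\<delta> * 2 ^ N)"
    using m s16 unfolding s_def by linarith
  also have "\<dots> = (16 / 15 * sqrt \<delta>) * (sqrt \<delta> * 2 ^ N)" using \<delta> by simp
  also have "\<dots> \<le> 1 * (sqrt \<delta> * 2 ^ N)"
    using sq \<delta> by (intro mult_right_mono) auto
  finally have m_le: "real m \<le> sqrt \<delta> * 2 ^ N" by simp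
  have logk: "0 < log 2 (real k)" using k by simp
  have L: "0 < log 2 (1 / \<delta>)" using \<delta> by simp
  have "2 * N * log 2 k < 2 / 5 * (s * log 2 (1 / \<delta>))"
    using N logk by (simp add: s_def field_simps)
  also have "\<dots> \<le> 1 / 2 * (s * log 2 (1 / \<delta>))"
    using L by (intro mult_right_mono) auto
  finally have "2 powr (2 * N * log 2 k) < 2 powr (s / 2 * log 2 (1 / \<delta>))"
    by simp
  moreover have "2 powr (2 * N * log 2 k) = real k ^ (2 * N)"
  proof -
    have "2 powr (2 * N * log 2 k) = (2 powr log 2 k) powr (2 * N)"
      by (simp add: powr_powr mult_ac)
    also have "\<dots> = real k powr (real (2 * N))" using k by simp
    also have "\<dots> = real k ^ (2 * N)" using k by (intro powr_realpow) auto
    finally show ?thesis .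
  qed
  moreover have "2 powr (s / 2 * log 2 (1 / \<delta>)) = (1 / sqrt \<delta>) ^ s"
  proof -
    have "2 powr (s / 2 * log 2 (1 / \<delta>)) = ((2 powr log 2 (1 / \<delta>)) powr (1 / 2)) powr s"
      by (simp add: powr_powr mult_ac)
    also have "\<dots> = (1 / sqrt \<delta>) ^ s"
      using \<delta> by (simp add: powr_half_sqrt real_sqrt_divide powr_realpow)
    finally show ?thesis .
  qed
  ultimately have kN: "real k ^ (2 * N) < (1 / sqrt \<delta>) ^ s" by (simp only:)
  \<comment> \<open>Here \<open>k \<ge> 4\<close> lets a single power of \<open>k\<close> pay for
    both the base sets and the labellings.\<close>
  have "2 * (k + 1) \<le> k * k"
  proof -
    have "2 * (k + 1) \<le> 4 * k" using k by simp
    also have "\<dots> \<le> k * k" using k by (intro mult_le_mono1)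
    finally show ?thesis .
  qed
  then have "(2 * (k + 1)) ^ N \<le> (k * k) ^ N" by (rule power_mono) simp
  then have "2 ^ N * (k + 1) ^ N \<le> k ^ (2 * N)"
    by (simp only: power_mult_distrib power_mult power2_eq_square)
  then have "real (2 ^ N * (k + 1) ^ N) \<le> real k ^ (2 * N)"
    by (metis of_nat_le_iff of_nat_power)
  then have "real (2 ^ N * (k + 1) ^ N * m ^ s) \<le> real k ^ (2 * N) * (sqrt \<delta> * 2 ^ N) ^ s"
    unfolding of_nat_mult[of _ "m ^ s"] of_nat_power[of m]
    using m_le by (intro mult_mono power_mono) auto
  also have "\<dots> < (1 / sqrt \<delta>) ^ s * (sqrt \<delta> * 2 ^ N) ^ s"
    using kN \<delta> by (intro mult_strict_right_mono) auto
  also have "\<dots> = real ((2 ^ N) ^ s)"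
    using \<delta> by (simp flip: power_mult_distrib)
  finally show ?thesis unfolding s_def of_nat_less_iff .
qed

theorem mainTheorem8:
  fixes k :: nat and \<delta> :: real
  assumes "k \<ge> 4" and "0 < \<delta>" and "\<delta> < 1 / 2"
  shows "real (Emb1 \<delta> k) \<ge> 1 / 5 * (2 ^ k * log 2 (1 / \<delta>) / log 2 (real k))"
proof (rule ccontr)
  define N where "N = Emb1 \<delta> k"
  assume "\<not> ?thesis"
  then have N: "real N < 1 / 5 * (2 ^ k * log 2 (1 / \<delta>) / log 2 (real k))"
    by (simp add: N_def)
  have emb: "\<forall>D \<subseteq> cube N. real (card D) \<ge> \<delta> * 2 ^ N \<longrightarrow> contains_scaled_cube k N D"
    unfolding N_def Emb1_def
    by (rule LeastI_ex) (rule exists_dimension_containing_scaled_cube[OF assms(2)])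
  \<comment> \<open>Rounding up keeps a set of \<open>m\<close> points dense enough for
    \<open>emb\<close>, at the cost of the \<open>+ 1\<close> that the counting estimate
    allows.\<close>
  define m where "m = nat \<lceil>\<delta> * 2 ^ N\<rceil>"
  have pos: "0 < \<delta> * 2 ^ N" using assms by simp
  then have m: "\<delta> * 2 ^ N \<le> real m" "real m \<le> \<delta> * 2 ^ N + 1" "0 < m"
    unfolding m_def by linarith+
  have "\<delta> * 2 ^ N \<le> 1 * 2 ^ N" using assms by (intro mult_right_mono) auto
  then have "\<lceil>\<delta> * 2 ^ N\<rceil> \<le> int (2 ^ N)" by (simp add: ceiling_le_iff)
  then have "m \<le> 2 ^ N" unfolding m_def by linarith
  then obtain D where "D \<subseteq> cube N" "card D = m" "\<not> contains_scaled_cube k N D"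
    using exists_subset_without_scaled_cube[of m N k] m cube_copies_count_less[OF assms N]
    by blast
  with emb m show False by auto
qed

end
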